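(* Let $Q\subset\mathbb{R}^2$ be a quadric with external centre $o=(0,0)$ and let $(Q,o;a,b)$ be a planar sector, i.e. $a,b\in Q$ are linearly independent. Let $\chi(Q,o;a,b)$ be its sector coefficient and $\delta:=\chi(Q,o;a,b)/2$. Then the sector region $Q^+$ of $(Q,o;a,b)$ is bounded if and only if $\delta>-1$. In that case its area $\mu(Q^+)$ is $$\mu(Q^{+})=\begin{cases}\Delta\,\dfrac{\arccos\delta}{\sqrt{1-\delta^{2}}} & \text{if } |\delta|<1 \text{ (elliptic case)},\\[2mm] \Delta & \text{if } \delta=1 \text{ (straight line case)},\\[2mm] \Delta\,\dfrac{\operatorname{arcosh}\delta}{\sqrt{\delta^{2}-1}} & \text{if } \delta>1 \text{ (hyperbolic case)},\end{cases}$$ where $\Delta$ denotes the area of the triangle with vertices $o,a,b$.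
   Context: A quadric of $\mathbb{R}^2$ is a non-empty set of the form $Q=\{x\in\mathbb{R}^2\mid q(x)+l(x)+\gamma=0\}$ with a quadratic form $q$, a linear form $l$ and a scalar $\gamma$. A point $c$ is a centre of $Q$ if $2c-x\in Q$ for all $x\in Q$; it is an external centre if moreover $c\notin Q$. For a planar sector $(Q,o;a,b)$ the sector coefficient $\chi(Q,o;a,b)$ is the unique $\beta\in\mathbb{R}$ such that $\{(x,y)\in\mathbb{R}^2\mid xa+yb\in Q\}=\{(x,y)\in\mathbb{R}^2\mid x^2+\beta xy+y^2=1\}$. The sector region is $Q^+:=\{xa+yb\mid x,y\ge 0,\ x^2+\beta xy+y^2\le 1\}$. $\mu$ is Lebesgue measure (area) on $\mathbb{R}^2$. Bounded means bounded in the Euclidean norm. *)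

theory Defs
  imports "HOL-Analysis.Analysis"
begin

definition quadratic_form :: "(real^2 \<Rightarrow> real) \<Rightarrow> bool" where
  "quadratic_form q \<longleftrightarrow> (\<exists>B :: real^2 \<Rightarrow> real^2 \<Rightarrow> real. bilinear B \<and> (\<forall>x. q x = B x x))"

definition quadric :: "(real^2) set \<Rightarrow> bool" where
  "quadric Q \<longleftrightarrow> Q \<noteq> {} \<and>
     (\<exists>q l \<gamma>. quadratic_form q \<and> linear l \<and> Q = {x. q x + l x + \<gamma> = 0})"

definition centre :: "(real^2) set \<Rightarrow> real^2 \<Rightarrow> bool" where
  "centre Q c \<longleftrightarrow> (\<forall>x\<in>Q. 2 *\<^sub>R c - x \<in> Q)"

definition external_centre :: "(real^2) set \<Rightarrow> real^2 \<Rightarrow> bool" where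
  "external_centre Q c \<longleftrightarrow> centre Q c \<and> c \<notin> Q"

text \<open>
  The centre \<open>o\<close> of a planar sector \<open>(Q, o; a, b)\<close> is the origin throughout, so the
  constants below do not take it as an argument. The condition \<open>a \<noteq> b\<close> is
  needed because \<^const>\<open>independent\<close> is a property of the set of the two vectors.
\<close>

definition planar_sector :: "(real^2) set \<Rightarrow> real^2 \<Rightarrow> real^2 \<Rightarrow> bool" where
  "planar_sector Q a b \<longleftrightarrow>
     quadric Q \<and> external_centre Q 0 \<and> a \<in> Q \<and> b \<in> Q \<and> a \<noteq> b \<and> independent {a, b}"

definition sector_coeff :: "(real^2) set \<Rightarrow> real^2 \<Rightarrow> real^2 \<Rightarrow> real" where
  "sector_coeff Q a b = (THE \<beta>.
     {(x, y). x *\<^sub>R a + y *\<^sub>R b \<in> Q} = {(x, y). x\<^sup>2 + \<beta> * x * y + y\<^sup>2 = 1})"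

definition sector_region :: "(real^2) set \<Rightarrow> real^2 \<Rightarrow> real^2 \<Rightarrow> (real^2) set" where
  "sector_region Q a b = {x *\<^sub>R a + y *\<^sub>R b | x y.
     0 \<le> x \<and> 0 \<le> y \<and> x\<^sup>2 + sector_coeff Q a b * x * y + y\<^sup>2 \<le> 1}"

end

theory Submission
  imports Defs "HOL-Real_Asymp.Real_Asymp"
begin

text \<open>
  In the coordinates \<open>(x, y)\<close> of the point \<open>x a + y b\<close> the sector region is the standard region
  \<open>{x, y \<ge> 0, x\<^sup>2 + 2 \<delta> x y + y\<^sup>2 \<le> 1}\<close>, so it is the image of that region under a linear map. The
  triangle with vertices \<open>0, a, b\<close> is the image of the standard triangle of area \<open>1/2\<close> under the
  same map. Areas scale by the absolute value of the determinant, hence the area of the sector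
  region is \<open>2 \<Delta>\<close> times that of the standard region (\<open>measure_sector_image\<close>), and everything
  reduces to a computation that depends on \<open>\<delta>\<close> only.

  On the positive quadrant the form \<open>x\<^sup>2 + 2 \<delta> x y + y\<^sup>2\<close> dominates a positive multiple of
  \<open>x\<^sup>2 + y\<^sup>2\<close> if \<open>\<delta> > -1\<close>, whereas for \<open>\<delta> \<le> -1\<close> it is nonpositive on the diagonal \<open>x = y\<close>, and the
  region contains the ray from the origin through \<open>a + b\<close>. This is the criterion for boundedness
  (\<open>bounded_sector_image_iff\<close>).

  For the area, the slope \<open>t = y / x\<close> replaces \<open>y\<close>. The points of slope \<open>t \<ge> 0\<close> in the region are
  those with \<open>x \<le> 1 / sqrt (1 + 2 \<delta> t + t\<^sup>2)\<close>, and \<open>dx dy = x dx dt\<close>, so that the area is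
  \<open>1/2\<close> times the integral of \<open>1 / (1 + 2 \<delta> t + t\<^sup>2)\<close> over all \<open>t \<ge> 0\<close> (\<open>emeasure_std_sector\<close>).
  This one formula covers all three cases; they differ only in the antiderivative, which is an
  arctangent, a rational function or a difference of logarithms according to whether the
  discriminant \<open>\<delta>\<^sup>2 - 1\<close> is negative, zero or positive.
\<close>

section \<open>The standard sector and its coordinate map\<close>

definition std_sector :: "real \<Rightarrow> (real^2) set" where
  "std_sector \<delta> = {v. 0 \<le> v$1 \<and> 0 \<le> v$2 \<and> (v$1)\<^sup>2 + 2 * \<delta> * v$1 * v$2 + (v$2)\<^sup>2 \<le> 1}"

definition sector_map :: "real^2 \<Rightarrow> real^2 \<Rightarrow> real^2 \<Rightarrow> real^2" where
  "sector_map a b v = v$1 *\<^sub>R a + v$2 *\<^sub>R b"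

section \<open>Lebesgue measure on the plane as a product measure\<close>

lemma measurable_vector_pair:
  "(\<lambda>p::real \<times> real. vector [fst p, snd p] :: real^2) \<in> borel_measurable borel"
proof (rule borel_measurable_continuous_onI)
  have comp: "(\<lambda>p::real \<times> real. vector [fst p, snd p] :: real^2) =
      (\<lambda>p. fst p *\<^sub>R axis 1 1 + snd p *\<^sub>R axis 2 1)"
    by (auto simp: fun_eq_iff vec_eq_iff forall_2 axis_def)
  show "continuous_on UNIV (\<lambda>p::real \<times> real. vector [fst p, snd p] :: real^2)"
    unfolding comp by (intro continuous_intros)
qed

text \<open>
  Identifies the plane of vectors with the product type, on which Tonelli's theorem is available.
  A measure that gives every box its volume is Lebesgue measure, so only boxes need checking.
\<close>

lemma lborel_real2:
  "distr lborel borel (\<lambda>p. vector [fst p, snd p]) = (lborel :: (real^2) measure)" (is "distr _ _ ?f = _")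
proof (rule lborel_eqI[symmetric])
  show "sets (distr lborel borel ?f) = sets borel" by simp
  fix l u :: "real^2"
  assume lu: "\<And>b. b \<in> Basis \<Longrightarrow> l \<bullet> b \<le> u \<bullet> b"
  have le: "l $ i \<le> u $ i" for i
    using lu[of "axis i 1"] by (simp add: inner_axis)
  have "emeasure (distr lborel borel ?f) (box l u) = emeasure lborel (?f -` box l u)"
    by (subst emeasure_distr) (auto simp: measurable_vector_pair)
  also have "?f -` box l u = {l$1<..<u$1} \<times> {l$2<..<u$2}"
    by (auto simp: mem_box Basis_vec_def inner_axis forall_2)
  also have "emeasure lborel \<dots> = ennreal ((u$1 - l$1) * (u$2 - l$2))"
    unfolding lborel_prod[symmetric]
    by (subst lborel.emeasure_pair_measure_Times) (auto simp: le ennreal_mult mult.commute)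
  also have "\<dots> = ennreal (\<Prod>b\<in>Basis. (u - l) \<bullet> b)"
    by (simp add: Basis_vec_def inner_axis UNIV_2 axis_eq_axis mult.commute)
  finally show "emeasure (distr lborel borel ?f) (box l u) = ennreal (\<Prod>b\<in>Basis. (u - l) \<bullet> b)" .
qed

section \<open>Boundedness of the standard sector\<close>

text \<open>
  For \<open>\<delta> < 0\<close> the bound comes from \<open>2 x y \<le> x\<^sup>2 + y\<^sup>2\<close>; for \<open>\<delta> \<ge> 0\<close> the mixed term is nonnegative
  because the point lies in the positive quadrant.
\<close>

lemma sector_form_lower_bound:
  fixes \<delta> x y :: real
  assumes "\<delta> > -1" "0 \<le> x" "0 \<le> y"
  shows "min 1 (1 + \<delta>) * (x\<^sup>2 + y\<^sup>2) \<le> x\<^sup>2 + 2 * \<delta> * x * y + y\<^sup>2"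
proof (cases "\<delta> \<ge> 0")
  case True
  then show ?thesis using assms by (simp add: min_def)
next
  case False
  have "2 * x * y \<le> x\<^sup>2 + y\<^sup>2" by (rule sum_squares_bound)
  then have "\<delta> * (x\<^sup>2 + y\<^sup>2) \<le> \<delta> * (2 * x * y)"
    using False by (intro mult_left_mono_neg) auto
  then show ?thesis using False by (simp add: min_def algebra_simps)
qed

lemma sector_density_pos:
  fixes \<delta> t :: real
  assumes "\<delta> > -1" "0 \<le> t"
  shows "0 < 1 + 2 * \<delta> * t + t\<^sup>2"
proof -
  have "0 < min 1 (1 + \<delta>) * (1\<^sup>2 + t\<^sup>2)"
    using assms by (intro mult_pos_pos add_pos_nonneg) auto
  also have "\<dots> \<le> 1 + 2 * \<delta> * t + t\<^sup>2"
    using sector_form_lower_bound[OF assms(1), of 1 t] assms by simp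
  finally show ?thesis .
qed

lemma compact_std_sector:
  assumes "\<delta> > -1"
  shows "compact (std_sector \<delta>)"
proof -
  define R where "R = 1 / min 1 (1 + \<delta>)"
  have m: "min 1 (1 + \<delta>) > 0" using assms by simp
  have "norm v \<le> sqrt R" if "v \<in> std_sector \<delta>" for v
  proof -
    have "min 1 (1 + \<delta>) * ((v$1)\<^sup>2 + (v$2)\<^sup>2) \<le> 1"
      using that sector_form_lower_bound[OF assms, of "v$1" "v$2"] by (auto simp: std_sector_def)
    then have "(v$1)\<^sup>2 + (v$2)\<^sup>2 \<le> R"
      using m by (simp add: R_def pos_le_divide_eq mult.commute)
    then show ?thesis by (simp add: norm_vec_def L2_set_def sum_2)
  qed
  then have "bounded (std_sector \<delta>)" by (auto simp: bounded_iff)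
  moreover have "closed (std_sector \<delta>)"
    unfolding std_sector_def by (intro closed_Collect_conj closed_Collect_le continuous_intros)
  ultimately show ?thesis by (simp add: compact_eq_bounded_closed)
qed

section \<open>The area of the standard sector\<close>

text \<open>
  For fixed \<open>x > 0\<close> the substitution \<open>y = x t\<close> is linear in \<open>t\<close> and contributes the factor \<open>x\<close>. After
  exchanging the integrals, the inner one is that of \<open>x\<close> over \<open>{0..1 / sqrt (1 + 2 \<delta> t + t\<^sup>2)}\<close>.
  Tonelli's theorem for nonnegative functions suffices, so the two-dimensional change of
  variables is avoided.
\<close>

lemma emeasure_std_sector:
  assumes "\<delta> > -1"
  shows "emeasure lborel (std_sector \<delta>) =
    (\<integral>\<^sup>+t. ennreal (1 / (2 * (1 + 2 * \<delta> * t + t\<^sup>2))) * indicator {0..} t \<partial>lborel)"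
proof -
  define P where "P = {(x::real, y). 0 \<le> x \<and> 0 \<le> y \<and> x\<^sup>2 + 2 * \<delta> * x * y + y\<^sup>2 \<le> 1}"
  have "closed P"
    unfolding P_def case_prod_unfold
    by (intro closed_Collect_conj closed_Collect_le continuous_intros)
  then have [measurable]: "P \<in> sets borel" by (rule borel_closed)
  then have P': "P \<in> sets (lborel \<Otimes>\<^sub>M lborel)" unfolding lborel_prod by simp
  have "emeasure lborel (std_sector \<delta>) =
      emeasure (distr lborel borel (\<lambda>p. vector [fst p, snd p])) (std_sector \<delta>)"
    by (simp add: lborel_real2)
  also have "\<dots> = emeasure lborel P"
    using compact_std_sector[OF assms]
    by (subst emeasure_distr)
      (auto simp: borel_compact measurable_vector_pair P_def std_sector_def intro!: arg_cong[where f = "emeasure lborel"])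
  also have "\<dots> = (\<integral>\<^sup>+x. \<integral>\<^sup>+y. indicator P (x, y) \<partial>lborel \<partial>lborel)"
    unfolding lborel_prod[symmetric] by (rule lborel.emeasure_pair_measure[OF P'])
  also have "\<dots> = (\<integral>\<^sup>+x. \<integral>\<^sup>+t. ennreal x * indicator {0<..} x * indicator P (x, x * t) \<partial>lborel \<partial>lborel)"
  proof (rule nn_integral_cong_AE)
    show "AE x in lborel. (\<integral>\<^sup>+y. indicator P (x, y) \<partial>lborel) =
        (\<integral>\<^sup>+t. ennreal x * indicator {0<..} x * indicator P (x, x * t) \<partial>lborel)"
      using AE_lborel_singleton[of "0::real"]
    proof eventually_elim
      case (elim x)
      show ?case
      proof (cases "x > 0")
        case True
        then show ?thesis
          by (subst nn_integral_real_affine[where c = x and t = 0]) (auto simp: nn_integral_cmult)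
      next
        case False
        with elim have "indicator P (x, y) = (0::ennreal)" for y by (auto simp: P_def)
        then show ?thesis by simp
      qed
    qed
  qed
  also have "\<dots> = (\<integral>\<^sup>+t. \<integral>\<^sup>+x. ennreal x * indicator {0<..} x * indicator P (x, x * t) \<partial>lborel \<partial>lborel)"
  proof (rule lborel_pair.Fubini')
    have [measurable]: "snd \<in> borel_measurable (borel :: (real \<times> real) measure)"
      by (intro borel_measurable_continuous_onI continuous_intros)
    have "(\<lambda>z::real \<times> real. (snd z, snd z * fst z)) \<in> borel \<rightarrow>\<^sub>M borel"
      by (intro borel_measurable_continuous_onI continuous_intros)
    then have [measurable]: "(\<lambda>z. indicator P (snd z, snd z * fst z) :: ennreal) \<in> borel_measurable borel"
      by (rule measurable_compose) measurable
    show "(\<lambda>(t, x). ennreal x * indicator {0<..} x * indicator P (x, x * t))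
        \<in> borel_measurable (lborel \<Otimes>\<^sub>M lborel)"
      unfolding lborel_prod case_prod_unfold by measurable
  qed
  also have "\<dots> = (\<integral>\<^sup>+t. ennreal (1 / (2 * (1 + 2 * \<delta> * t + t\<^sup>2))) * indicator {0..} t \<partial>lborel)"
  proof (rule nn_integral_cong)
    fix t :: real
    define p where "p = 1 + 2 * \<delta> * t + t\<^sup>2"
    show "(\<integral>\<^sup>+x. ennreal x * indicator {0<..} x * indicator P (x, x * t) \<partial>lborel) =
        ennreal (1 / (2 * (1 + 2 * \<delta> * t + t\<^sup>2))) * indicator {0..} t"
    proof (cases "t \<ge> 0")
      case False
      then have "(\<lambda>x. ennreal x * indicator {0<..} x * indicator P (x, x * t)) = (\<lambda>_. 0)"
        by (auto simp: fun_eq_iff P_def indicator_def zero_le_mult_iff)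
      then show ?thesis using False by simp
    next
      case True
      have p: "p > 0" unfolding p_def by (rule sector_density_pos[OF assms True])
      have "ennreal x * indicator {0<..} x * indicator P (x, x * t) =
          ennreal x * indicator {0..1 / sqrt p} x" for x
      proof (cases "x > 0")
        case x: True
        have "x\<^sup>2 + 2 * \<delta> * x * (x * t) + (x * t)\<^sup>2 = x\<^sup>2 * p"
          by (simp add: p_def power2_eq_square algebra_simps)
        moreover have "x\<^sup>2 * p \<le> 1 \<longleftrightarrow> x \<le> 1 / sqrt p"
        proof -
          have "x \<le> 1 / sqrt p \<longleftrightarrow> x * sqrt p \<le> 1" using p by (simp add: pos_le_divide_eq)
          also have "\<dots> \<longleftrightarrow> (x * sqrt p)\<^sup>2 \<le> 1"
            using p x by (simp add: abs_square_le_1)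
          finally show ?thesis using p by (simp add: power_mult_distrib)
        qed
        ultimately show ?thesis using x True by (auto simp: P_def indicator_def)
      qed (auto simp: indicator_def)
      then have "(\<integral>\<^sup>+x. ennreal x * indicator {0<..} x * indicator P (x, x * t) \<partial>lborel) =
          (\<integral>\<^sup>+x. ennreal x * indicator {0..1 / sqrt p} x \<partial>lborel)" by simp
      also have "\<dots> = ennreal ((1 / sqrt p)\<^sup>2 / 2 - 0\<^sup>2 / 2)"
        using p by (intro nn_integral_FTC_Icc) (auto intro!: derivative_eq_intros)
      also have "\<dots> = ennreal (1 / (2 * p))" using p by (simp add: power_divide)
      finally show ?thesis using True by (simp add: p_def)
    qed
  qed
  finally show ?thesis .
qed

text \<open>
  Reduces each of the three cases to an antiderivative and its limit at infinity.
\<close>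

lemma measure_std_sector:
  fixes \<delta> :: real
  assumes \<delta>: "\<delta> > -1"
    and F: "\<And>t. 0 \<le> t \<Longrightarrow> (F has_real_derivative 1 / (2 * (1 + 2 * \<delta> * t + t\<^sup>2))) (at t)"
    and lim: "(F \<longlongrightarrow> L) at_top"
  shows "measure lebesgue (std_sector \<delta>) = L - F 0"
proof -
  have nonneg: "0 \<le> 1 / (2 * (1 + 2 * \<delta> * t + t\<^sup>2))" if "0 \<le> t" for t
    using sector_density_pos[OF \<delta> that] by simp
  have deriv_nonneg: "\<exists>y. (F has_real_derivative y) (at t) \<and> 0 \<le> y" if "0 \<le> t" for t
    using F[OF that] nonneg[OF that] by blast
  have "emeasure lborel (std_sector \<delta>) = ennreal (L - F 0)"
    unfolding emeasure_std_sector[OF \<delta>]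
    by (rule nn_integral_FTC_atLeast[OF _ F nonneg lim]) simp_all
  \<comment> \<open>Without this, \<open>ennreal\<close> could have truncated a negative value.\<close>
  moreover have "F 0 \<le> L"
  proof (rule tendsto_lowerbound[OF lim])
    show "\<forall>\<^sub>F t in at_top. F 0 \<le> F t"
      using eventually_ge_at_top[of 0]
      by eventually_elim (rule DERIV_nonneg_imp_nondecreasing, assumption, rule deriv_nonneg)
  qed simp
  ultimately show ?thesis
    using compact_std_sector[OF \<delta>] by (simp add: measure_def borel_compact)
qed

text \<open>
  Completing the square, \<open>1 + 2 \<delta> t + t\<^sup>2 = s\<^sup>2 + (t + \<delta>)\<^sup>2\<close> with \<open>s\<^sup>2 = 1 - \<delta>\<^sup>2\<close>, gives an arctangent,
  and \<open>arccos \<delta>\<close> appears as the complementary angle of \<open>arctan (\<delta> / s)\<close>.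
\<close>

lemma measure_std_sector_elliptic:
  assumes "\<bar>\<delta>\<bar> < 1"
  shows "measure lebesgue (std_sector \<delta>) = arccos \<delta> / sqrt (1 - \<delta>\<^sup>2) / 2"
proof -
  define s where "s = sqrt (1 - \<delta>\<^sup>2)"
  have s: "s > 0" "s\<^sup>2 = 1 - \<delta>\<^sup>2"
    using assms by (auto simp: s_def abs_square_less_1 less_imp_le)
  define F where "F = (\<lambda>t. arctan ((t + \<delta>) / s) / (2 * s))"
  have arccos: "arccos \<delta> = pi / 2 - arctan (\<delta> / s)"
    unfolding s_def using assms by (intro arccos_arctan) auto
  have "measure lebesgue (std_sector \<delta>) = pi / (4 * s) - F 0"
  proof (rule measure_std_sector)
    show "\<delta> > -1" using assms by simp
    show "(F \<longlongrightarrow> pi / (4 * s)) at_top"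
      unfolding F_def using s by real_asymp (simp add: field_simps)
    fix t :: real
    have "1 + ((t + \<delta>) / s)\<^sup>2 = (s\<^sup>2 + (t + \<delta>)\<^sup>2) / s\<^sup>2"
      using s(1) by (simp add: field_simps)
    also have "s\<^sup>2 + (t + \<delta>)\<^sup>2 = 1 + 2 * \<delta> * t + t\<^sup>2"
      unfolding s(2) by (simp add: power2_eq_square algebra_simps)
    finally have *: "1 + ((t + \<delta>) / s)\<^sup>2 = (1 + 2 * \<delta> * t + t\<^sup>2) / s\<^sup>2" .
    have "((\<lambda>t. t + \<delta>) has_real_derivative 1) (at t)"
      by (auto intro!: derivative_eq_intros)
    from DERIV_cdivide[OF DERIV_chain2[OF DERIV_arctan DERIV_cdivide[OF this]]]
    have "(F has_real_derivative inverse (1 + ((t + \<delta>) / s)\<^sup>2) * (1 / s) / (2 * s)) (at t)"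
      unfolding F_def .
    also have "inverse (1 + ((t + \<delta>) / s)\<^sup>2) * (1 / s) / (2 * s) = 1 / (2 * (1 + 2 * \<delta> * t + t\<^sup>2))"
      unfolding * using s(1) by (simp add: power2_eq_square)
    finally show "(F has_real_derivative 1 / (2 * (1 + 2 * \<delta> * t + t\<^sup>2))) (at t)" .
  qed
  also have "pi / (4 * s) - F 0 = arccos \<delta> / s / 2"
    unfolding arccos F_def using s(1) by (simp add: field_simps)
  finally show ?thesis by (simp add: s_def)
qed

lemma measure_std_sector_line: "measure lebesgue (std_sector 1) = 1 / 2"
proof -
  define F where "F = (\<lambda>t::real. - inverse (1 + t) / 2)"
  have "measure lebesgue (std_sector 1) = 0 - F 0"
  proof (rule measure_std_sector)
    show "(F \<longlongrightarrow> 0) at_top" unfolding F_def by real_asymp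
    fix t :: real assume "0 \<le> t"
    then have "((\<lambda>t. - inverse (1 + t)) has_real_derivative 1 / (1 + t)\<^sup>2) (at t)"
      by (auto intro!: derivative_eq_intros simp: power2_eq_square field_simps)
    then have "(F has_real_derivative 1 / (1 + t)\<^sup>2 / 2) (at t)"
      unfolding F_def by (rule DERIV_cdivide)
    also have "1 / (1 + t)\<^sup>2 / 2 = 1 / (2 * (1 + 2 * 1 * t + t\<^sup>2))"
      by (simp add: power2_sum algebra_simps)
    finally show "(F has_real_derivative 1 / (2 * (1 + 2 * 1 * t + t\<^sup>2))) (at t)" .
  qed simp
  then show ?thesis by (simp add: F_def)
qed

lemma tendsto_ln_shift_diff:
  fixes c d :: real
  shows "((\<lambda>t. ln (t + c) - ln (t + d)) \<longlongrightarrow> 0) at_top"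
proof -
  have "((\<lambda>t. (t + c) / (t + d)) \<longlongrightarrow> 1) at_top" by real_asymp
  then have "((\<lambda>t. ln ((t + c) / (t + d))) \<longlongrightarrow> ln 1) at_top"
    by (rule tendsto_ln) simp
  also have "?this \<longleftrightarrow> ?thesis"
  proof (intro filterlim_cong refl)
    show "\<forall>\<^sub>F t in at_top. ln ((t + c) / (t + d)) = ln (t + c) - ln (t + d)"
      using eventually_gt_at_top[of "\<bar>c\<bar> + \<bar>d\<bar>"]
      by eventually_elim (subst ln_div, auto)
  qed simp
  finally show ?thesis .
qed

text \<open>
  Here \<open>1 + 2 \<delta> t + t\<^sup>2\<close> splits into the factors \<open>t + \<delta> - s\<close> and \<open>t + \<delta> + s\<close> with \<open>s\<^sup>2 = \<delta>\<^sup>2 - 1\<close>, and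
  partial fractions give logarithms.
\<close>

lemma measure_std_sector_hyperbolic:
  assumes "\<delta> > 1"
  shows "measure lebesgue (std_sector \<delta>) = arcosh \<delta> / sqrt (\<delta>\<^sup>2 - 1) / 2"
proof -
  define s where "s = sqrt (\<delta>\<^sup>2 - 1)"
  have "\<delta>\<^sup>2 > 1" using assms by simp
  then have s: "s > 0" "s\<^sup>2 = \<delta>\<^sup>2 - 1" by (auto simp: s_def)
  have "s\<^sup>2 < \<delta>\<^sup>2" by (simp add: s(2))
  then have "s < \<delta>" by (rule power2_less_imp_less) (use assms in simp)
  define F where "F = (\<lambda>t. (ln (t + (\<delta> - s)) - ln (t + (\<delta> + s))) / (4 * s))"
  have "measure lebesgue (std_sector \<delta>) = 0 - F 0"
  proof (rule measure_std_sector)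
    show "\<delta> > -1" using assms by simp
    show "(F \<longlongrightarrow> 0) at_top"
      unfolding F_def by (intro tendsto_divide_zero tendsto_ln_shift_diff)
    fix t :: real assume t: "0 \<le> t"
    have pos: "t + (\<delta> - s) > 0" "t + (\<delta> + s) > 0" using t s \<open>s < \<delta>\<close> by auto
    have prod: "(t + (\<delta> - s)) * (t + (\<delta> + s)) = 1 + 2 * \<delta> * t + t\<^sup>2"
      using s(2) by (simp add: power2_eq_square algebra_simps)
    have "((\<lambda>t. ln (t + (\<delta> - s)) - ln (t + (\<delta> + s))) has_real_derivative
        1 / (t + (\<delta> - s)) - 1 / (t + (\<delta> + s))) (at t)"
      using pos by (auto intro!: derivative_eq_intros)
    then have "(F has_real_derivative (1 / (t + (\<delta> - s)) - 1 / (t + (\<delta> + s))) / (4 * s)) (at t)"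
      unfolding F_def by (rule DERIV_cdivide)
    also have "1 / (t + (\<delta> - s)) - 1 / (t + (\<delta> + s)) = 2 * s / (1 + 2 * \<delta> * t + t\<^sup>2)"
      unfolding prod[symmetric] using pos by (simp add: diff_frac_eq)
    also have "2 * s / (1 + 2 * \<delta> * t + t\<^sup>2) / (4 * s) = 1 / (2 * (1 + 2 * \<delta> * t + t\<^sup>2))"
    proof -
      have "2 * s / q / (4 * s) = 1 / (2 * q)" for q
        using s(1) by (simp add: field_simps)
      then show ?thesis .
    qed
    finally show "(F has_real_derivative 1 / (2 * (1 + 2 * \<delta> * t + t\<^sup>2))) (at t)" .
  qed
  also have "\<dots> = ln (\<delta> + s) / s / 2"
  proof -
    \<comment> \<open>The two logarithms at \<open>t = 0\<close> are opposite, since the factors there have product \<open>1\<close>.\<close>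
    have "(\<delta> - s) * (\<delta> + s) = 1" using s(2) by (simp add: power2_eq_square algebra_simps)
    then have "\<delta> - s = inverse (\<delta> + s)" by (metis inverse_unique mult.commute)
    then have "ln (\<delta> - s) = - ln (\<delta> + s)" using s assms by (simp add: ln_inverse)
    then show ?thesis using s by (simp add: F_def)
  qed
  finally show ?thesis using assms by (simp add: s_def arcosh_real_def)
qed

section \<open>Transfer to the sector region\<close>

lemma linear_sector_map: "linear (sector_map a b)"
  by (auto simp: sector_map_def linear_iff algebra_simps)

lemma sector_region_eq_image:
  "sector_region Q a b = sector_map a b ` std_sector (sector_coeff Q a b / 2)"
proof (intro set_eqI iffI)
  fix w assume "w \<in> sector_region Q a b"
  then obtain x y where "w = x *\<^sub>R a + y *\<^sub>R b" "0 \<le> x" "0 \<le> y"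
      "x\<^sup>2 + sector_coeff Q a b * x * y + y\<^sup>2 \<le> 1"
    by (auto simp: sector_region_def)
  then have "w = sector_map a b (vector [x, y])"
      "vector [x, y] \<in> std_sector (sector_coeff Q a b / 2)"
    by (auto simp: sector_map_def std_sector_def)
  then show "w \<in> sector_map a b ` std_sector (sector_coeff Q a b / 2)" by blast
qed (auto simp: sector_region_def sector_map_def std_sector_def)

text \<open>
  For \<open>\<delta> \<le> -1\<close> the standard sector contains the whole diagonal ray \<open>x = y \<ge> 0\<close>. Its image is the
  ray through \<open>a + b\<close>, which is unbounded because \<open>a + b \<noteq> 0\<close>.
\<close>

lemma bounded_sector_image_iff:
  assumes "a + b \<noteq> 0"
  shows "bounded (sector_map a b ` std_sector \<delta>) \<longleftrightarrow> \<delta> > -1"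
proof
  assume "\<delta> > -1"
  then show "bounded (sector_map a b ` std_sector \<delta>)"
    by (intro bounded_linear_image compact_imp_bounded compact_std_sector)
      (auto simp: linear_linear linear_sector_map)
next
  assume "bounded (sector_map a b ` std_sector \<delta>)"
  then obtain R where R: "norm v \<le> R" if "v \<in> sector_map a b ` std_sector \<delta>" for v
    by (auto simp: bounded_iff)
  show "\<delta> > -1"
  proof (rule ccontr)
    assume "\<not> \<delta> > -1"
    then have le: "1 + \<delta> \<le> 0" by simp
    have ray: "x * norm (a + b) \<le> R" if "x \<ge> 0" for x
    proof -
      have "x\<^sup>2 * (1 + \<delta>) \<le> 0" using le by (simp add: mult_nonneg_nonpos)
      then have "vector [x, x] \<in> std_sector \<delta>"
        using that by (simp add: std_sector_def power2_eq_square algebra_simps)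
      then have "norm (sector_map a b (vector [x, x])) \<le> R" by (intro R imageI)
      also have "sector_map a b (vector [x, x]) = x *\<^sub>R (a + b)"
        by (simp add: sector_map_def algebra_simps)
      finally show ?thesis using that by simp
    qed
    have "R \<ge> 0" using ray[of 0] by simp
    \<comment> \<open>This multiple of \<open>a + b\<close> has norm \<open>R + 1\<close>.\<close>
    then show False using ray[of "(R + 1) / norm (a + b)"] assms by simp
  qed
qed

text \<open>
  The factor by which the map scales areas is \<open>\<bar>a\<^sub>1 b\<^sub>2 - b\<^sub>1 a\<^sub>2\<bar>\<close>, which is twice the area of the
  triangle.
\<close>

lemma measure_sector_image:
  assumes "\<delta> > -1"
  shows "measure lebesgue (sector_map a b ` std_sector \<delta>) =
    2 * measure lebesgue (convex hull {0, a, b}) * measure lebesgue (std_sector \<delta>)"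
proof -
  have "measure lebesgue (sector_map a b ` std_sector \<delta>) =
      \<bar>det (matrix (sector_map a b))\<bar> * measure lebesgue (std_sector \<delta>)"
    using assms by (intro measure_linear_image linear_sector_map lmeasurable_compact compact_std_sector)
  also have "det (matrix (sector_map a b)) = a$1 * b$2 - b$1 * a$2"
    by (simp add: det_2 matrix_def sector_map_def axis_def)
  also have "compact (convex hull {0, a, b})"
    by (intro finite_imp_compact_convex_hull) auto
  then have "\<bar>a$1 * b$2 - b$1 * a$2\<bar> = 2 * measure lebesgue (convex hull {0, a, b})"
    using content_triangle[of 0 a b] by (simp add: borel_compact abs_minus_commute mult.commute)
  finally show ?thesis .
qed

theorem theorem3p2:
  fixes Q :: "(real^2) set" and a b :: "real^2" and \<delta> \<Delta> :: real
  assumes "planar_sector Q a b"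
    and "\<delta> = sector_coeff Q a b / 2"
    and "\<Delta> = measure lebesgue (convex hull {0, a, b})"
  shows "(bounded (sector_region Q a b) \<longleftrightarrow> \<delta> > -1) \<and>
    (bounded (sector_region Q a b) \<longrightarrow>
      (\<bar>\<delta>\<bar> < 1 \<longrightarrow> measure lebesgue (sector_region Q a b) = \<Delta> * (arccos \<delta> / sqrt (1 - \<delta>\<^sup>2))) \<and>
      (\<delta> = 1 \<longrightarrow> measure lebesgue (sector_region Q a b) = \<Delta>) \<and>
      (\<delta> > 1 \<longrightarrow> measure lebesgue (sector_region Q a b) = \<Delta> * (arcosh \<delta> / sqrt (\<delta>\<^sup>2 - 1))))"
proof -
  have "a + b \<noteq> 0"
  proof
    assume "a + b = 0"
    then have "a = - b" by (simp add: add_eq_0_iff2)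
    then have "a \<in> span {b}" by (metis span_base span_neg singletonI)
    then show False
      using assms(1) by (auto simp: planar_sector_def independent_insert)
  qed
  have region: "sector_region Q a b = sector_map a b ` std_sector \<delta>"
    unfolding assms(2) by (rule sector_region_eq_image)
  show ?thesis
    unfolding region bounded_sector_image_iff[OF \<open>a + b \<noteq> 0\<close>]
    by (auto simp: measure_sector_image assms(3)[symmetric] measure_std_sector_elliptic
        measure_std_sector_line measure_std_sector_hyperbolic)
qed

end
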